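(* If $\Delta=\{\nu_k\}_{k\ge1}$ is an increasing sequence of positive integers with $$\gamma_\Delta=\sup_{k\in\mathbb N}(\nu_{k+1}-\nu_k)=\infty,$$ then there exists a function $f\in\mathcal F(\mathcal{DR}^2_\Delta)$ such that $$\limsup_{\mathrm{len}(R)\to0,\ x\in R\in\mathcal{DR}^2}\left|\frac1{|R|}\int_Rf(t)\,dt\right|=\infty$$ for any $x\in\mathbb R^2$.
   Context: $\mathcal{DR}^2$ is the family of dyadic rectangles $\left[\frac{j_1-1}{2^{m_1}},\frac{j_1}{2^{m_1}}\right)\times\left[\frac{j_2-1}{2^{m_2}},\frac{j_2}{2^{m_2}}\right)$ with $j_1,j_2,m_1,m_2\in\mathbb Z$, and $\mathcal{DR}^2_\Delta$ is the subfamily with $m_1,m_2\in\Delta$. $\mathrm{len}(R)$ is the length of the bigger side of $R$. For a family $\mathcal B$ of bounded sets of positive measure in $\mathbb R^2$ such that every point is contained in members of arbitrarily small diameter (a differentiation basis), and $f\in L_{\rm loc}(\mathbb R^2)$ (locally integrable), set $$\delta_{\mathcal B}(x,f)=\limsup_{\mathrm{diam}(E)\to0,\ x\in E\in\mathcal B}\left|\frac1{|E|}\int_Ef(t)\,dt-f(x)\right| ,$$ and $\mathcal F(\mathcal B)=\{f\in L_{\rm loc}(\mathbb R^2):\ \delta_{\mathcal B}(x,f)=0\text{ for almost every }x\}$. *)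

theory Defs
  imports "HOL-Analysis.Analysis"
begin

text \<open>The plane is \<^typ>\<open>real \<times> real\<close>, whose metric is the Euclidean one; measurability and
  integrals are with respect to Lebesgue measure.\<close>

definition differentiation_basis :: "(real \<times> real) set set \<Rightarrow> bool" where
  "differentiation_basis B \<longleftrightarrow>
     (\<forall>E\<in>B. bounded E \<and> E \<in> sets lebesgue \<and> measure lebesgue E > 0) \<and>
     (\<forall>x. \<forall>\<epsilon>>0. \<exists>E\<in>B. x \<in> E \<and> diameter E < \<epsilon>)"

definition locally_integrable :: "(real \<times> real \<Rightarrow> real) \<Rightarrow> bool" where
  "locally_integrable f \<longleftrightarrow> (\<forall>K. compact K \<longrightarrow> set_integrable lebesgue K f)"

definition average :: "(real \<times> real) set \<Rightarrow> (real \<times> real \<Rightarrow> real) \<Rightarrow> real" where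
  "average E f = (LINT t:E|lebesgue. f t) / measure lebesgue E"

text \<open>The filter on sets describing the limit ``\<open>s(E) \<rightarrow> 0\<close>, \<open>x \<in> E \<in> B\<close>'', for a size function
  \<open>s\<close> such as the diameter.\<close>

definition shrinking_at ::
  "((real \<times> real) set \<Rightarrow> real) \<Rightarrow> (real \<times> real) set set \<Rightarrow> real \<times> real \<Rightarrow> (real \<times> real) set filter" where
  "shrinking_at s B x = inf (filtercomap s (nhds 0)) (principal {E \<in> B. x \<in> E})"

definition diff_defect ::
  "(real \<times> real) set set \<Rightarrow> real \<times> real \<Rightarrow> (real \<times> real \<Rightarrow> real) \<Rightarrow> ereal" where
  "diff_defect B x f =
     Limsup (shrinking_at diameter B x) (\<lambda>E. ereal \<bar>average E f - f x\<bar>)"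

definition differentiated_functions ::
  "(real \<times> real) set set \<Rightarrow> (real \<times> real \<Rightarrow> real) set" where
  "differentiated_functions B =
     {f. locally_integrable f \<and> (AE x in lebesgue. diff_defect B x f = 0)}"

definition dyadic_interval :: "int \<Rightarrow> int \<Rightarrow> real set" where
  "dyadic_interval m j = {(of_int j - 1) / 2 powi m ..< of_int j / 2 powi m}"

definition dyadic_rectangles :: "int set \<Rightarrow> (real \<times> real) set set" where
  "dyadic_rectangles \<Delta> =
     {dyadic_interval m1 j1 \<times> dyadic_interval m2 j2 | m1 m2 j1 j2. m1 \<in> \<Delta> \<and> m2 \<in> \<Delta>}"

text \<open>The sides of a rectangle are recovered from the set as its two coordinate projections.\<close>

definition longer_side :: "(real \<times> real) set \<Rightarrow> real" where
  "longer_side R = max (measure lborel (fst ` R)) (measure lborel (snd ` R))"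

lemma longer_side_rectangle:
  assumes "a < b" "c < d"
  shows "longer_side ({a..<b} \<times> {c..<d}) = max (b - a) (d - c)"
  using assms by (simp add: longer_side_def)

lemma dyadic_interval_alt:
  "dyadic_interval m j = {(of_int j - 1) / 2 powi m ..< (of_int j - 1) / 2 powi m + 1 / 2 powi m}"
  by (simp add: dyadic_interval_def diff_divide_distrib)

lemma shrinking_at_eventually:
  "eventually P (shrinking_at s B x) \<longleftrightarrow>
     (\<exists>\<epsilon>>0. \<forall>E\<in>B. x \<in> E \<longrightarrow> \<bar>s E\<bar> < \<epsilon> \<longrightarrow> P E)"
  unfolding shrinking_at_def eventually_inf_principal eventually_filtercomap
    eventually_nhds_metric dist_real_def
proof
  assume "\<exists>Q. (\<exists>d>0. \<forall>y. \<bar>y - 0\<bar> < d \<longrightarrow> Q y) \<and> (\<forall>E. Q (s E) \<longrightarrow> E \<in> {E \<in> B. x \<in> E} \<longrightarrow> P E)"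
  then show "\<exists>\<epsilon>>0. \<forall>E\<in>B. x \<in> E \<longrightarrow> \<bar>s E\<bar> < \<epsilon> \<longrightarrow> P E"
    by fastforce
next
  assume "\<exists>\<epsilon>>0. \<forall>E\<in>B. x \<in> E \<longrightarrow> \<bar>s E\<bar> < \<epsilon> \<longrightarrow> P E"
  then obtain \<epsilon> where "\<epsilon> > 0" "\<forall>E\<in>B. x \<in> E \<longrightarrow> \<bar>s E\<bar> < \<epsilon> \<longrightarrow> P E" by blast
  then show "\<exists>Q. (\<exists>d>0. \<forall>y. \<bar>y - 0\<bar> < d \<longrightarrow> Q y) \<and> (\<forall>E. Q (s E) \<longrightarrow> E \<in> {E \<in> B. x \<in> E} \<longrightarrow> P E)"
    by (intro exI[of _ "\<lambda>y. \<bar>y\<bar> < \<epsilon>"]) auto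
qed

lemma differentiation_basis_dyadic_rectangles:
  assumes unbdd: "\<And>N. \<exists>m\<in>\<Delta>. N < m"
  shows "differentiation_basis (dyadic_rectangles \<Delta>)"
  unfolding differentiation_basis_def
proof (intro conjI ballI allI impI)
  fix E assume "E \<in> dyadic_rectangles \<Delta>"
  then obtain m1 m2 j1 j2 where E: "E = dyadic_interval m1 j1 \<times> dyadic_interval m2 j2"
    by (auto simp: dyadic_rectangles_def)
  have bi: "bounded (dyadic_interval m j)" for m j
    by (simp add: dyadic_interval_def)
  show "bounded E" unfolding E by (intro bounded_Times bi)
  have b: "dyadic_interval m j \<in> sets borel" for m j
    by (simp add: dyadic_interval_def)
  have EB: "E \<in> sets borel"
    unfolding E using b by (metis borel_prod pair_measureI)
  then show "E \<in> sets lebesgue" by simp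
  have m: "emeasure lborel (dyadic_interval m j) = ennreal (1 / 2 powi m)" for m j
    by (simp add: dyadic_interval_alt)
  have "emeasure lborel E = ennreal (1 / 2 powi m1) * ennreal (1 / 2 powi m2)"
    unfolding E lborel_prod[symmetric] m[of m1 j1, symmetric] m[of m2 j2, symmetric]
    by (rule lborel.emeasure_pair_measure_Times) (use b in auto)
  then have "measure lborel E = (1 / 2 powi m1) * (1 / 2 powi m2)"
    by (simp add: measure_def enn2real_mult)
  then show "measure lebesgue E > 0"
    using EB by (simp add: measure_completion)
next
  fix x :: "real \<times> real" and \<epsilon> :: real
  assume "\<epsilon> > 0"
  then obtain n where n: "(1 / 2) ^ n < \<epsilon> / 2"
    using real_arch_pow_inv[of "\<epsilon> / 2" "1 / 2"] by auto
  obtain m where m: "m \<in> \<Delta>" "int n < m" using unbdd by blast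
  define h :: real where "h = 1 / 2 powi m"
  have hpos: "h > 0" by (simp add: h_def)
  have "(2::real) powi int n \<le> 2 powi m"
    using m by (intro power_int_increasing) auto
  then have "h \<le> (1 / 2) ^ n"
    by (simp add: h_def power_one_over frac_le)
  then have h: "h < \<epsilon> / 2" using n by linarith
  define I where "I t = dyadic_interval m (\<lfloor>t * 2 powi m\<rfloor> + 1)" for t :: real
  have tI: "t \<in> I t" for t
    unfolding I_def dyadic_interval_def by (simp add: field_simps) linarith
  have dI: "dist s t \<le> h" if "s \<in> I u" "t \<in> I u" for s t u
    using that unfolding I_def dyadic_interval_alt dist_real_def h_def[symmetric] by auto
  have "diameter (I (fst x) \<times> I (snd x)) \<le> 2 * h"
  proof (rule diameter_le)
    show "I (fst x) \<times> I (snd x) \<noteq> {} \<or> 0 \<le> 2 * h" using hpos by simp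
    fix p q assume "p \<in> I (fst x) \<times> I (snd x)" "q \<in> I (fst x) \<times> I (snd x)"
    then have "dist (fst p) (fst q) \<le> h" "dist (snd p) (snd q) \<le> h"
      by (auto intro: dI)
    moreover have "dist p q \<le> dist (fst p) (fst q) + dist (snd p) (snd q)"
      unfolding dist_prod_def by (rule sqrt_sum_squares_le_sum) auto
    ultimately show "norm (p - q) \<le> 2 * h" by (simp add: dist_norm)
  qed
  moreover have "I (fst x) \<times> I (snd x) \<in> dyadic_rectangles \<Delta>"
    unfolding dyadic_rectangles_def I_def using m by blast
  moreover have "x \<in> I (fst x) \<times> I (snd x)"
    using tI by (cases x) auto
  ultimately show "\<exists>E\<in>dyadic_rectangles \<Delta>. x \<in> E \<and> diameter E < \<epsilon>"
    using h by (intro bexI[of _ "I (fst x) \<times> I (snd x)"]) auto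
qed

end

theory Submission
  imports Defs
begin

text \<open>The function is a sum of nonnegative layers, one for each member of a sequence of long gaps of
  the scale sequence. A layer is periodic with the scale at the beginning of its gap and constant on
  squares at or before the end of the gap. For rectangles with sides in the sequence the layer is then
  nearly invisible, because such a rectangle lies, in each direction, within one cell or covers whole
  periods. All the averages over such rectangles are therefore bounded by a sum of four functions
  (\<open>pattern_majorant\<close>): the layer, its means along horizontal and vertical strips, and its mean over a
  period. This majorant has integral comparable to that of the layer. If the integrals are summable, the
  majorants are summable at almost every point, which gives differentiation there: all but finitely many
  layers contribute an arbitrarily small amount, and the others are constant on small admissible
  rectangles (\<open>diff_defect_layer_sum\<close>).

  General dyadic rectangles, in contrast, can use the scales inside the gap. The failure of a weak type
  \<open>(1, 1)\<close> estimate for the strong maximal function allows a layer to have mean at most \<open>\<mu>\<close> and still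
  have at each point a dyadic rectangle with average at least \<open>\<Lambda>\<close>, for any \<open>\<Lambda>\<close> and any \<open>\<mu> > 0\<close>, if
  the gap is long enough (\<open>covering_pattern_exists\<close>). The basic gain comes from a single mass at a corner:
  it serves all the dyadic rectangles of a given area at that corner, whose union, a hyperbolic cross, has
  an area larger by a factor of order \<open>n\<close> when \<open>n\<close> scales are available. One cross covers only part of a
  square, so the construction is repeated in the squares it misses (\<open>covering_pattern_step\<close>). After
  finitely many repetitions what is left has so small a measure that the constant \<open>\<Lambda>\<close> can be put
  there; this is why every point, and not only almost every point, is served. The theorem follows by
  taking \<open>\<Lambda> = k\<close> and \<open>\<mu> = (1 / 2) ^ k\<close> in the \<open>k\<close>-th layer.\<close>

section \<open>Means over dyadic blocks of integers\<close>

text \<open>The integers are the addresses of the dyadic intervals of one fixed generation; the block at level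
  \<open>c\<close> around \<open>i\<close> collects the \<open>2 ^ c\<close> addresses that share with \<open>i\<close> the ancestor \<open>c\<close> generations up.\<close>
definition dyadic_block :: "nat \<Rightarrow> int \<Rightarrow> int set" where
  "dyadic_block c i = {k. k div 2 ^ c = i div 2 ^ c}"

definition block_mean :: "nat \<Rightarrow> (int \<Rightarrow> real) \<Rightarrow> int \<Rightarrow> real" where
  "block_mean c h i = (\<Sum>k\<in>dyadic_block c i. h k) / 2 ^ c"

definition block_mean2 :: "nat \<Rightarrow> nat \<Rightarrow> (int \<Rightarrow> int \<Rightarrow> real) \<Rightarrow> int \<Rightarrow> int \<Rightarrow> real" where
  "block_mean2 c d G i j = block_mean c (\<lambda>k. block_mean d (G k) j) i"

lemma dyadic_block_interval:
  "dyadic_block c i = {i div 2 ^ c * 2 ^ c ..< i div 2 ^ c * 2 ^ c + 2 ^ c}"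
proof -
  have "k div 2 ^ c = z \<longleftrightarrow> z * 2 ^ c \<le> k \<and> k < z * 2 ^ c + 2 ^ c" for k z :: int
  proof
    assume "k div 2 ^ c = z"
    then have "k = z * 2 ^ c + k mod 2 ^ c" by (metis div_mult_mod_eq)
    moreover have "0 \<le> k mod 2 ^ c" "k mod 2 ^ c < 2 ^ c" by auto
    ultimately show "z * 2 ^ c \<le> k \<and> k < z * 2 ^ c + 2 ^ c" by linarith
  next
    assume "z * 2 ^ c \<le> k \<and> k < z * 2 ^ c + 2 ^ c"
    then show "k div 2 ^ c = z"
      by (intro int_div_pos_eq[of _ _ _ "k - z * 2 ^ c"]) auto
  qed
  then show ?thesis
    by (auto simp: dyadic_block_def)
qed

lemma finite_dyadic_block [simp]: "finite (dyadic_block c i)"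
  by (simp add: dyadic_block_interval)

lemma card_dyadic_block [simp]: "card (dyadic_block c i) = 2 ^ c"
  by (simp add: dyadic_block_interval nat_power_eq)

lemma self_mem_dyadic_block [simp]: "i \<in> dyadic_block c i"
  by (simp add: dyadic_block_def)

lemma dyadic_block_0 [simp]: "dyadic_block 0 i = {i}"
  by (auto simp: dyadic_block_def)

lemma div_power_add: "k div 2 ^ (c + d) = k div 2 ^ c div 2 ^ d" for k :: int
  by (simp add: power_add zdiv_zmult2_eq)

lemma block_mean_0 [simp]: "block_mean 0 h i = h i"
  by (simp add: block_mean_def)

lemma block_mean_const [simp]: "block_mean c (\<lambda>_. v) i = v"
  by (simp add: block_mean_def)

lemma block_mean_add: "block_mean c (\<lambda>k. g k + h k) i = block_mean c g i + block_mean c h i"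
  by (simp add: block_mean_def sum.distrib add_divide_distrib)

lemma block_mean_cong:
  "(\<And>k. k \<in> dyadic_block c i \<Longrightarrow> g k = h k) \<Longrightarrow> block_mean c g i = block_mean c h i"
  unfolding block_mean_def by (simp cong: sum.cong)

lemma block_mean_nonneg: "(\<And>k. 0 \<le> h k) \<Longrightarrow> 0 \<le> block_mean c h i"
  unfolding block_mean_def by (simp add: sum_nonneg)

lemma block_mean2_swap: "block_mean2 c d G i j = block_mean d (\<lambda>l. block_mean c (\<lambda>k. G k l) i) j"
  unfolding block_mean2_def block_mean_def sum_divide_distrib
  by (subst sum.swap) (simp add: mult.commute)

lemma block_mean2_sum:
  "block_mean2 c d G i j = (\<Sum>k\<in>dyadic_block c i. \<Sum>l\<in>dyadic_block d j. G k l) / (2 ^ c * 2 ^ d)"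
  unfolding block_mean2_def block_mean_def by (simp flip: sum_divide_distrib)

lemma block_mean2_nonneg: "(\<And>k l. 0 \<le> G k l) \<Longrightarrow> 0 \<le> block_mean2 c d G i j"
  by (simp add: block_mean2_def block_mean_nonneg)

text \<open>A block of level \<open>L + n\<close> falls into \<open>2 ^ n\<close> blocks of level \<open>L\<close>, told apart by the digit
  \<open>k div 2 ^ L mod 2 ^ n\<close>. This is the change of scale behind every recursion on levels.\<close>
lemma dyadic_block_digit:
  assumes "0 \<le> s" "s < 2 ^ n"
  shows "{k \<in> dyadic_block (L + n) i. k div 2 ^ L mod 2 ^ n = s} =
    dyadic_block L ((2 ^ n * (i div 2 ^ (L + n)) + s) * 2 ^ L)"
proof -
  have "(k div 2 ^ L div 2 ^ n = z \<and> k div 2 ^ L mod 2 ^ n = s) \<longleftrightarrow> k div 2 ^ L = 2 ^ n * z + s"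
    for k z :: int
    using assms mult_div_mod_eq[of "2 ^ n" "k div 2 ^ L"] by auto
  then show ?thesis
    by (auto simp: dyadic_block_def div_power_add)
qed

lemma sum_dyadic_block_split:
  fixes h :: "int \<Rightarrow> real"
  shows "(\<Sum>k\<in>dyadic_block (L + n) i. h k) =
    (\<Sum>s\<in>{0..<2 ^ n}. \<Sum>k\<in>dyadic_block L ((2 ^ n * (i div 2 ^ (L + n)) + s) * 2 ^ L). h k)"
proof -
  have "(\<Sum>k\<in>dyadic_block (L + n) i. h k) =
    (\<Sum>s\<in>{0..<2 ^ n}. \<Sum>k\<in>{k \<in> dyadic_block (L + n) i. k div 2 ^ L mod 2 ^ n = s}. h k)"
    by (rule sum.group[symmetric]) auto
  also have "\<dots> = (\<Sum>s\<in>{0..<2 ^ n}. \<Sum>k\<in>dyadic_block L ((2 ^ n * (i div 2 ^ (L + n)) + s) * 2 ^ L). h k)"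
    by (intro sum.cong refl dyadic_block_digit) auto
  finally show ?thesis .
qed

lemma sum_dyadic_block_periodic:
  fixes h :: "int \<Rightarrow> real"
  assumes "\<And>k k'. k mod 2 ^ L = k' mod 2 ^ L \<Longrightarrow> h k = h k'"
  shows "(\<Sum>k\<in>dyadic_block L i. h k) = (\<Sum>r\<in>{0..<2 ^ L}. h r)"
proof (rule sum.reindex_bij_witness[of _ "\<lambda>r. i div 2 ^ L * 2 ^ L + r" "\<lambda>k. k mod 2 ^ L"])
  fix k assume "k \<in> dyadic_block L i"
  then have "k div 2 ^ L = i div 2 ^ L" by (simp add: dyadic_block_def)
  then show "i div 2 ^ L * 2 ^ L + k mod 2 ^ L = k"
    by (metis div_mult_mod_eq)
  show "h (k mod 2 ^ L) = h k"
    by (rule assms) simp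
qed (auto simp: dyadic_block_def)

lemma block_mean_periodic:
  assumes "\<And>k k'. k mod 2 ^ L = k' mod 2 ^ L \<Longrightarrow> h k = h k'" and "L \<le> c"
  shows "block_mean c h i = block_mean L h j"
proof -
  obtain n where c: "c = L + n" using \<open>L \<le> c\<close> le_Suc_ex by blast
  have "(\<Sum>k\<in>dyadic_block L i'. h k) = (\<Sum>r\<in>{0..<2 ^ L}. h r)" for i'
    by (rule sum_dyadic_block_periodic) (rule assms(1))
  then show ?thesis
    unfolding block_mean_def c sum_dyadic_block_split by (simp add: power_add)
qed

section \<open>Covering patterns of small mean\<close>

text \<open>The finite combinatorial core: a doubly periodic weight that is cheap (mean at most \<open>\<mu>\<close> over a
  period) although its dyadic maximal function, taken over rectangles inside one period, is at least
  \<open>\<Lambda>\<close> at every single cell. Periodicity is what makes averages over very long strips equal to averages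
  over strips of one period.\<close>
definition covering_pattern :: "real \<Rightarrow> real \<Rightarrow> nat \<Rightarrow> (int \<Rightarrow> int \<Rightarrow> real) \<Rightarrow> bool" where
  "covering_pattern \<Lambda> \<mu> L G \<longleftrightarrow>
     (\<forall>i j. 0 \<le> G i j) \<and>
     (\<forall>i i' j j'. i mod 2 ^ L = i' mod 2 ^ L \<longrightarrow> j mod 2 ^ L = j' mod 2 ^ L \<longrightarrow> G i j = G i' j') \<and>
     (\<forall>i j. block_mean2 L L G i j \<le> \<mu>) \<and>
     (\<forall>i j. \<exists>c\<le>L. \<exists>d\<le>L. \<Lambda> \<le> block_mean2 c d G i j)"

lemma covering_pattern_mono:
  assumes "covering_pattern \<Lambda> \<mu> L G" and "\<mu> \<le> \<mu>'"
  shows "covering_pattern \<Lambda> \<mu>' L G"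
proof -
  have "block_mean2 L L G i j \<le> \<mu>" for i j
    using assms(1) unfolding covering_pattern_def by blast
  then have "block_mean2 L L G i j \<le> \<mu>'" for i j
    using assms(2) order_trans by blast
  then show ?thesis
    using assms(1) unfolding covering_pattern_def by blast
qed

text \<open>The union of all dyadic rectangles of area \<open>2 ^ n\<close> that sit at the corner of the square of side
  \<open>2 ^ n\<close>. All of them are charged by one mass at the corner cell, and since their union exceeds each
  of them in area by a factor of order \<open>n\<close>, one mass does the work of many.\<close>
definition hyperbolic_cross :: "nat \<Rightarrow> (int \<times> int) set" where
  "hyperbolic_cross n =
     {(s, t). 0 \<le> s \<and> 0 \<le> t \<and> (\<exists>e\<le>n. s < 2 ^ e \<and> t < 2 ^ (n - e))}"

lemma hyperbolic_cross_subset: "hyperbolic_cross n \<subseteq> {0..<2 ^ n} \<times> {0..<2 ^ n}"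
proof -
  have "(2::int) ^ e \<le> 2 ^ n" "(2::int) ^ (n - e) \<le> 2 ^ n" if "e \<le> n" for e
    using that by (auto intro: power_increasing)
  then show ?thesis
    unfolding hyperbolic_cross_def by (fastforce intro: less_le_trans)
qed

text \<open>The pieces \<open>2 ^ e \<le> s < 2 ^ (e + 1)\<close>, \<open>t < 2 ^ (n - e - 1)\<close> are disjoint and have \<open>2 ^ (n - 1)\<close>
  cells each.\<close>
lemma card_hyperbolic_cross: "real n * 2 ^ n / 2 \<le> real (card (hyperbolic_cross n))"
proof -
  define S where "S e = {(2::int) ^ e..<2 ^ Suc e} \<times> {0..<(2::int) ^ (n - Suc e)}" for e :: nat
  have "S e \<inter> S e' = {}" if "e < e'" for e e'
  proof -
    have "(2::int) ^ Suc e \<le> 2 ^ e'"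
      using that by (intro power_increasing) auto
    then show ?thesis by (auto simp: S_def)
  qed
  then have disj: "S e \<inter> S e' = {}" if "e \<noteq> e'" for e e'
    using that by (metis Int_commute linorder_neqE_nat)
  have "card (S e) = 2 ^ (n - 1)" if "e < n" for e
  proof -
    have "card (S e) = 2 ^ e * 2 ^ (n - Suc e)"
      by (simp add: S_def nat_power_eq)
    also have "\<dots> = 2 ^ (n - 1)"
      using that by (simp flip: power_add)
    finally show ?thesis .
  qed
  then have "card (\<Union>e<n. S e) = n * 2 ^ (n - 1)"
    using disj by (subst card_UN_disjoint) (auto simp: S_def)
  moreover have "(\<Union>e<n. S e) \<subseteq> hyperbolic_cross n"
  proof
    fix z assume "z \<in> (\<Union>e<n. S e)"
    then obtain e where e: "e < n" "z \<in> S e" by blast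
    moreover have "(0::int) \<le> 2 ^ e" by simp
    ultimately show "z \<in> hyperbolic_cross n"
      unfolding hyperbolic_cross_def S_def by (auto intro!: exI[of _ "Suc e"])
  qed
  moreover have "finite (hyperbolic_cross n)"
    by (rule finite_subset[OF hyperbolic_cross_subset]) auto
  ultimately have "n * 2 ^ (n - 1) \<le> card (hyperbolic_cross n)"
    by (metis card_mono)
  then have "real n * 2 ^ (n - 1) \<le> real (card (hyperbolic_cross n))"
    using of_nat_mono[where 'a = real] by fastforce
  moreover have "real n * 2 ^ n / 2 = real n * 2 ^ (n - 1)"
    by (cases n) auto
  ultimately show ?thesis by linarith
qed

text \<open>Each period of the new pattern is a square of \<open>2 ^ n \<times> 2 ^ n\<close> big cells. The corner big cell gets
  the constant \<open>\<Lambda> * 2 ^ n\<close>, which serves the whole hyperbolic cross through rectangles of \<open>2 ^ n\<close> big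
  cells; the rest of the cross is left empty; the big cells outside the cross carry copies of the old
  pattern. So the corner costs \<open>\<Lambda> / 2 ^ n\<close> in the mean, and the old cost \<open>\<mu>\<close> is only paid on
  the part outside the cross.\<close>
lemma covering_pattern_step:
  assumes pat: "covering_pattern \<Lambda> \<mu> L G" and "0 \<le> \<Lambda>" "0 \<le> \<mu>"
  shows "\<exists>G'. covering_pattern \<Lambda> (\<Lambda> / 2 ^ n + (1 - real n / (2 * 2 ^ n)) * \<mu>) (L + n) G'"
proof -
  define D where "D k = k div 2 ^ L mod 2 ^ n" for k :: int
  define G' where "G' k l =
    (if D k = 0 \<and> D l = 0 then \<Lambda> * 2 ^ n
     else if (D k, D l) \<in> hyperbolic_cross n then 0 else G k l)" for k l
  have G_nonneg: "0 \<le> G k l" for k l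
    using pat unfolding covering_pattern_def by blast
  have G_mean: "block_mean2 L L G k l \<le> \<mu>" for k l
    using pat unfolding covering_pattern_def by blast
  have G'_nonneg: "0 \<le> G' k l" for k l
    using G_nonneg \<open>0 \<le> \<Lambda>\<close> by (simp add: G'_def)
  have D_range: "D k \<in> {0..<2 ^ n}" for k by (simp add: D_def)
  have D_block: "D k = s" if "k \<in> dyadic_block L ((2 ^ n * z + s) * 2 ^ L)" "s \<in> {0..<2 ^ n}" for k z s
    using that by (simp add: D_def dyadic_block_def)
  have periodic: "G' i j = G' i' j'"
    if "i mod 2 ^ (L + n) = i' mod 2 ^ (L + n)" "j mod 2 ^ (L + n) = j' mod 2 ^ (L + n)" for i i' j j'
  proof -
    have D: "D k = k mod 2 ^ (L + n) div 2 ^ L" for k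
      by (simp add: D_def power_add zmod_zmult2_eq)
    have coarser: "k mod 2 ^ L = k' mod 2 ^ L" if "k mod 2 ^ (L + n) = k' mod 2 ^ (L + n)" for k k' :: int
      using arg_cong[OF that, of "\<lambda>r. r mod 2 ^ L"] by (simp add: mod_mod_cancel power_add)
    have "i mod 2 ^ L = i' mod 2 ^ L" "j mod 2 ^ L = j' mod 2 ^ L"
      using that by (auto intro: coarser)
    then have "G i j = G i' j'"
      using pat unfolding covering_pattern_def by blast
    then show ?thesis
      using that by (simp add: G'_def D)
  qed
  have mean: "block_mean2 (L + n) (L + n) G' i j \<le> \<Lambda> / 2 ^ n + (1 - real n / (2 * 2 ^ n)) * \<mu>" for i j
  proof -
    \<comment> \<open>\<open>W z\<close> bounds the mean of the new pattern over the big cell with digits \<open>z\<close>.\<close>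
    define W where "W z = (if z = (0, 0) then \<Lambda> * 2 ^ n else 0) + (if z \<in> hyperbolic_cross n then 0 else \<mu>)"
      for z :: "int \<times> int"
    \<comment> \<open>The first address of the \<open>s\<close>-th big cell in the period containing \<open>i\<close>.\<close>
    define b where "b i s = (2 ^ n * (i div 2 ^ (L + n)) + s) * 2 ^ L" for i s :: int
    have cell: "(\<Sum>k\<in>dyadic_block L (b i s). \<Sum>l\<in>dyadic_block L (b j t). G' k l) \<le> W (s, t) * (2 ^ L * 2 ^ L)"
      if st: "s \<in> {0..<2 ^ n}" "t \<in> {0..<2 ^ n}" for s t
    proof -
      have Ds: "D k = s" if "k \<in> dyadic_block L (b i s)" for k
        using D_block st that unfolding b_def by blast
      have Dt: "D l = t" if "l \<in> dyadic_block L (b j t)" for l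
        using D_block st that unfolding b_def by blast
      have "(\<Sum>k\<in>dyadic_block L (b i s). \<Sum>l\<in>dyadic_block L (b j t). G' k l) =
        (\<Sum>k\<in>dyadic_block L (b i s). \<Sum>l\<in>dyadic_block L (b j t).
          (if (s, t) = (0, 0) then \<Lambda> * 2 ^ n else if (s, t) \<in> hyperbolic_cross n then 0 else G k l))"
        by (intro sum.cong refl) (simp add: G'_def Ds Dt)
      also have "\<dots> \<le> W (s, t) * (2 ^ L * 2 ^ L)"
      proof -
        have "(0, 0) \<in> hyperbolic_cross n"
          by (auto simp: hyperbolic_cross_def)
        then show ?thesis
          using G_mean[of "b i s" "b j t"] \<open>0 \<le> \<mu>\<close>
          by (auto simp: W_def block_mean2_sum field_simps)
      qed
      finally show ?thesis .
    qed
    have "(\<Sum>k\<in>dyadic_block (L + n) i. \<Sum>l\<in>dyadic_block (L + n) j. G' k l) =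
      (\<Sum>s\<in>{0..<2 ^ n}. \<Sum>k\<in>dyadic_block L (b i s). \<Sum>t\<in>{0..<2 ^ n}. \<Sum>l\<in>dyadic_block L (b j t). G' k l)"
      unfolding sum_dyadic_block_split b_def by simp
    also have "\<dots> = (\<Sum>s\<in>{0..<2 ^ n}. \<Sum>t\<in>{0..<2 ^ n}. \<Sum>k\<in>dyadic_block L (b i s). \<Sum>l\<in>dyadic_block L (b j t). G' k l)"
      by (intro sum.cong refl sum.swap)
    also have "\<dots> \<le> (\<Sum>s\<in>{0..<2 ^ n}. \<Sum>t\<in>{0..<2 ^ n}. W (s, t) * (2 ^ L * 2 ^ L))"
      by (intro sum_mono cell)
    also have "\<dots> = (\<Sum>z\<in>{0..<2 ^ n} \<times> {0..<2 ^ n}. W z) * (2 ^ L * 2 ^ L)"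
      by (simp add: sum.cartesian_product sum_distrib_right case_prod_beta')
    also have "(\<Sum>z\<in>{0..<2 ^ n} \<times> {0..<2 ^ n}. W z) =
      \<Lambda> * 2 ^ n + ((2::real) ^ n * 2 ^ n - real (card (hyperbolic_cross n))) * \<mu>"
    proof -
      let ?Q = "{0..<(2::int) ^ n} \<times> {0..<(2::int) ^ n}"
      have "(\<Sum>z\<in>?Q. if z \<in> hyperbolic_cross n then 0 else \<mu>) = card (?Q - hyperbolic_cross n) * \<mu>"
        by (simp add: sum.If_cases Diff_eq)
      also have "real (card (?Q - hyperbolic_cross n)) = 2 ^ n * 2 ^ n - real (card (hyperbolic_cross n))"
      proof -
        have "card (hyperbolic_cross n) \<le> card ?Q"
          by (intro card_mono hyperbolic_cross_subset) auto
        moreover have "card (?Q - hyperbolic_cross n) = card ?Q - card (hyperbolic_cross n)"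
          by (intro card_Diff_subset hyperbolic_cross_subset finite_subset[OF hyperbolic_cross_subset]) auto
        ultimately show ?thesis
          by (simp add: nat_power_eq of_nat_diff)
      qed
      finally show ?thesis
        by (simp add: W_def sum.distrib)
    qed
    also have "\<dots> \<le> \<Lambda> * 2 ^ n + (2 ^ n * 2 ^ n - real n * 2 ^ n / 2) * \<mu>"
      using card_hyperbolic_cross[of n] \<open>0 \<le> \<mu>\<close> by (intro add_left_mono mult_right_mono) auto
    finally show ?thesis
      by (simp add: block_mean2_sum field_simps power_add)
  qed
  have cover: "\<exists>c\<le>L + n. \<exists>d\<le>L + n. \<Lambda> \<le> block_mean2 c d G' i j" for i j
  proof (cases "(D i, D j) \<in> hyperbolic_cross n")
    case True
    then obtain e where e: "e \<le> n" "D i < 2 ^ e" "D j < 2 ^ (n - e)"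
      by (auto simp: hyperbolic_cross_def)
    define b where "b i = 2 ^ n * (i div 2 ^ (L + n)) * 2 ^ L" for i :: int
    \<comment> \<open>The block of level \<open>L + e\<close> around \<open>i\<close> starts at the beginning of a period, so it
      contains the corner; levels \<open>L + e\<close> and \<open>L + (n - e)\<close> give the rectangle with mean \<open>\<Lambda>\<close>.\<close>
    have sub: "dyadic_block L (b i) \<subseteq> dyadic_block (L + e) i" if "D i < 2 ^ e" "e \<le> n" for i e
    proof -
      obtain m where n: "n = e + m" using \<open>e \<le> n\<close> le_Suc_ex by blast
      have "i div 2 ^ L = 2 ^ n * (i div 2 ^ (L + n)) + D i"
        unfolding D_def div_power_add by simp
      then have "i div 2 ^ L = D i + 2 ^ e * (2 ^ m * (i div 2 ^ (L + n)))"
        by (simp add: n power_add)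
      then have "i div 2 ^ (L + e) = (D i + 2 ^ e * (2 ^ m * (i div 2 ^ (L + n)))) div 2 ^ e"
        by (simp only: div_power_add[of i L e])
      also have "\<dots> = 2 ^ m * (i div 2 ^ (L + n))"
        using D_range[of i] that by (simp add: div_pos_pos_trivial)
      finally have "i div 2 ^ (L + e) = 2 ^ m * (i div 2 ^ (L + n))" .
      then show ?thesis
        by (auto simp: dyadic_block_def b_def div_power_add[of _ L e]) (simp add: n power_add mult.assoc)
    qed
    have "G' k l = \<Lambda> * 2 ^ n" if "k \<in> dyadic_block L (b i)" "l \<in> dyadic_block L (b j)" for k l
      using that D_block[where s = 0] by (simp add: G'_def b_def)
    then have "(\<Sum>k\<in>dyadic_block L (b i). \<Sum>l\<in>dyadic_block L (b j). G' k l) = 2 ^ L * (2 ^ L * (\<Lambda> * 2 ^ n))"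
      by simp
    moreover have "(\<Sum>k\<in>dyadic_block L (b i). \<Sum>l\<in>dyadic_block L (b j). G' k l) \<le>
      (\<Sum>k\<in>dyadic_block (L + e) i. \<Sum>l\<in>dyadic_block (L + (n - e)) j. G' k l)"
      unfolding sum.cartesian_product using e sub
      by (intro sum_mono2) (auto simp: G'_nonneg dest: subsetD[OF sub])
    moreover have "(2::real) ^ n = 2 ^ e * 2 ^ (n - e)"
      using e by (simp flip: power_add)
    ultimately have "\<Lambda> \<le> block_mean2 (L + e) (L + (n - e)) G' i j"
      by (simp add: block_mean2_sum pos_le_divide_eq power_add mult_ac)
    then show ?thesis
      using e by (intro exI[of _ "L + e"] exI[of _ "L + (n - e)"] conjI) auto
  next
    case False
    obtain c d where cd: "c \<le> L" "d \<le> L" "\<Lambda> \<le> block_mean2 c d G i j"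
      using pat unfolding covering_pattern_def by blast
    \<comment> \<open>A rectangle of the old pattern stays inside one big cell, where the new pattern is a copy of it.\<close>
    have same: "D k = D i" if "k \<in> dyadic_block c i" "c \<le> L" for k i c
    proof -
      obtain m where "L = c + m" using \<open>c \<le> L\<close> le_Suc_ex by blast
      then show ?thesis using that by (simp add: D_def dyadic_block_def div_power_add)
    qed
    have "G' k l = G k l" if "k \<in> dyadic_block c i" "l \<in> dyadic_block d j" for k l
      using False same[OF that(1) cd(1)] same[OF that(2) cd(2)]
      by (auto simp: G'_def hyperbolic_cross_def)
    then have "block_mean2 c d G' i j = block_mean2 c d G i j"
      by (simp add: block_mean2_sum)
    then show ?thesis
      using cd by (intro exI[of _ c] exI[of _ d] conjI) auto
  qed
  show ?thesis
    unfolding covering_pattern_def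
    by (intro exI[of _ G'] conjI allI impI G'_nonneg periodic mean cover)
qed

text \<open>Starting from the constant \<open>\<Lambda>\<close>, the step is a contraction of ratio \<open>1 - n / 2 ^ (n + 1)\<close> with
  fixed point \<open>2 * \<Lambda> / n\<close>. A large \<open>n\<close> makes the fixed point small, and many steps come close to it.\<close>
lemma covering_pattern_exists:
  assumes "0 \<le> \<Lambda>" "0 < \<mu>"
  shows "\<exists>L G. covering_pattern \<Lambda> \<mu> L G"
proof -
  obtain n :: nat where n: "4 * \<Lambda> / \<mu> < n" using reals_Archimedean2 by blast
  with assms have "n > 0" by (smt (verit) divide_nonneg_pos of_nat_0_less_iff)
  define c where "c = real n / (2 * 2 ^ n)"
  have "real n < 2 * 2 ^ n"
    by (rule order.strict_trans2[OF of_nat_less_two_power]) simp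
  with \<open>n > 0\<close> have c: "0 < c" "c < 1"
    by (simp_all add: c_def)
  have iter: "\<exists>L G. covering_pattern \<Lambda> (2 * \<Lambda> / n + \<Lambda> * (1 - c) ^ r) L G" for r
  proof (induction r)
    case 0
    have "covering_pattern \<Lambda> (2 * \<Lambda> / n + \<Lambda>) 0 (\<lambda>_ _. \<Lambda>)"
      using assms by (simp add: covering_pattern_def block_mean2_def)
    then show ?case by auto
  next
    case (Suc r)
    then obtain L G where "covering_pattern \<Lambda> (2 * \<Lambda> / n + \<Lambda> * (1 - c) ^ r) L G" by blast
    then have "\<exists>G'. covering_pattern \<Lambda> (\<Lambda> / 2 ^ n + (1 - c) * (2 * \<Lambda> / n + \<Lambda> * (1 - c) ^ r)) (L + n) G'"
      unfolding c_def by (rule covering_pattern_step) (use assms c c_def in auto)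
    moreover have "\<Lambda> / 2 ^ n + (1 - c) * (2 * \<Lambda> / n + \<Lambda> * (1 - c) ^ r) = 2 * \<Lambda> / n + \<Lambda> * (1 - c) ^ Suc r"
      using \<open>n > 0\<close> by (simp add: c_def field_simps)
    ultimately show ?case by metis
  qed
  have "(\<lambda>r. \<Lambda> * (1 - c) ^ r) \<longlonglongrightarrow> \<Lambda> * 0"
    using c by (intro tendsto_intros LIMSEQ_power_zero) auto
  then have "eventually (\<lambda>r. \<Lambda> * (1 - c) ^ r < \<mu> / 2) sequentially"
    using assms by (intro order_tendstoD) auto
  then obtain r where "\<Lambda> * (1 - c) ^ r < \<mu> / 2"
    by (auto simp: eventually_sequentially)
  moreover have "2 * \<Lambda> / n < \<mu> / 2"
    using n \<open>n > 0\<close> assms by (simp add: field_simps)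
  ultimately have "2 * \<Lambda> / n + \<Lambda> * (1 - c) ^ r \<le> \<mu>" by linarith
  moreover obtain L G where "covering_pattern \<Lambda> (2 * \<Lambda> / n + \<Lambda> * (1 - c) ^ r) L G"
    using iter by blast
  ultimately show ?thesis
    by (blast intro: covering_pattern_mono)
qed

section \<open>Averages over dyadic boxes\<close>

definition dyadic_index :: "nat \<Rightarrow> real \<Rightarrow> int" where
  "dyadic_index a u = \<lfloor>2 ^ a * u\<rfloor>"

text \<open>The dyadic rectangle with sides \<open>1 / 2 ^ a\<close> and \<open>1 / 2 ^ b\<close> that contains \<open>z\<close>. Naming it by one
  of its points instead of by its address suits statements about differentiation at \<open>z\<close>.\<close>
definition dyadic_box :: "nat \<Rightarrow> nat \<Rightarrow> real \<times> real \<Rightarrow> (real \<times> real) set" where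
  "dyadic_box a b z =
     {u. dyadic_index a u = dyadic_index a (fst z)} \<times> {v. dyadic_index b v = dyadic_index b (snd z)}"

definition grid_function :: "nat \<Rightarrow> (int \<Rightarrow> int \<Rightarrow> real) \<Rightarrow> real \<times> real \<Rightarrow> real" where
  "grid_function q G z = G (dyadic_index q (fst z)) (dyadic_index q (snd z))"

lemma dyadic_index_level: "{u. dyadic_index a u = i} = {of_int i / 2 ^ a ..< of_int i / 2 ^ a + 1 / 2 ^ a}"
  by (auto simp: dyadic_index_def floor_eq_iff field_simps)

lemma dyadic_interval_eq_level: "dyadic_interval (int a) j = {u. dyadic_index a u = j - 1}"
  by (simp add: dyadic_interval_alt dyadic_index_level)

lemma dyadic_index_coarsen: "dyadic_index a u = dyadic_index (a + c) u div 2 ^ c"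
proof -
  have "dyadic_index a u = \<lfloor>2 ^ (a + c) * u / of_int (2 ^ c)\<rfloor>"
    by (simp add: dyadic_index_def power_add)
  also have "\<dots> = dyadic_index (a + c) u div 2 ^ c"
    unfolding dyadic_index_def by (rule floor_divide_real_eq_div) simp
  finally show ?thesis .
qed

lemma dyadic_index_refine:
  assumes "dyadic_index b v = dyadic_index b u" and "a \<le> b"
  shows "dyadic_index a v = dyadic_index a u"
proof -
  obtain c where "b = a + c" using \<open>a \<le> b\<close> le_Suc_ex by blast
  then show ?thesis using assms(1) dyadic_index_coarsen[of a _ c] by simp
qed

lemma dyadic_index_mem_block:
  assumes "dyadic_index a v = dyadic_index a u"
  shows "dyadic_index q v \<in> dyadic_block (q - a) (dyadic_index q u)"
proof (cases "a \<le> q")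
  case True
  then obtain c where "q = a + c" using le_Suc_ex by blast
  then show ?thesis
    using assms dyadic_index_coarsen[of a _ c] by (simp add: dyadic_block_def)
next
  case False
  then show ?thesis using dyadic_index_refine[OF assms, of q] by simp
qed

text \<open>Truncated subtraction merges two cases: if \<open>a \<le> q\<close>, the interval of length \<open>1 / 2 ^ a\<close> splits into
  \<open>2 ^ (q - a)\<close> cells of generation \<open>q\<close>; if \<open>q < a\<close>, it lies inside a single cell, and \<open>q - a = 0\<close>.
  In both cases the interval is shared out equally over the addresses of one block.\<close>
lemma emeasure_dyadic_slice:
  assumes "i \<in> dyadic_block (q - a) (dyadic_index q u)"
  shows "emeasure lborel {v. dyadic_index a v = dyadic_index a u \<and> dyadic_index q v = i} =
    ennreal (1 / 2 ^ a / 2 ^ (q - a))"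
proof (cases "a \<le> q")
  case True
  then obtain c where q: "q = a + c" using le_Suc_ex by blast
  have "{v. dyadic_index a v = dyadic_index a u \<and> dyadic_index q v = i} = {v. dyadic_index q v = i}"
    using assms dyadic_index_coarsen[of a _ c] by (auto simp: dyadic_block_def q)
  then show ?thesis
    by (simp add: dyadic_index_level q power_add)
next
  case False
  then have "i = dyadic_index q u" using assms by simp
  then have "{v. dyadic_index a v = dyadic_index a u \<and> dyadic_index q v = i} =
    {v. dyadic_index a v = dyadic_index a u}"
    using False by (auto dest: dyadic_index_refine[where a = q])
  then show ?thesis
    using False by (simp add: dyadic_index_level)
qed

lemma sets_dyadic_level [measurable, simp]: "{u. dyadic_index a u = i} \<in> sets borel"
  by (simp add: dyadic_index_level)

lemma sets_dyadic_slice: "{v. dyadic_index a v = i \<and> dyadic_index q v = j} \<in> sets borel"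
proof -
  have "{v. dyadic_index a v = i \<and> dyadic_index q v = j} = {v. dyadic_index a v = i} \<inter> {v. dyadic_index q v = j}"
    by auto
  then show ?thesis by (simp only: sets.Int[OF sets_dyadic_level sets_dyadic_level])
qed

lemma has_bochner_integral_rectangle:
  fixes X Y :: "real set"
  assumes XY: "X \<in> sets borel" "Y \<in> sets borel"
    and m: "emeasure lborel X = ennreal s" "emeasure lborel Y = ennreal t" and "0 \<le> s" "0 \<le> t"
  shows "has_bochner_integral lebesgue (indicator (X \<times> Y) :: real \<times> real \<Rightarrow> real) (s * t)"
proof -
  have sets: "X \<times> Y \<in> sets borel"
    using XY by (metis borel_prod pair_measureI)
  have "emeasure lborel (X \<times> Y) = emeasure lborel X * emeasure lborel Y"
    unfolding lborel_prod[symmetric] by (rule lborel.emeasure_pair_measure_Times) (use XY in auto)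
  then have em: "emeasure lebesgue (X \<times> Y) = ennreal (s * t)"
    using sets m \<open>0 \<le> s\<close> by (simp add: ennreal_mult')
  then have "measure lebesgue (X \<times> Y) = s * t"
    using \<open>0 \<le> s\<close> \<open>0 \<le> t\<close> by (simp add: measure_def)
  moreover have "has_bochner_integral lebesgue (indicator (X \<times> Y) :: real \<times> real \<Rightarrow> real) (measure lebesgue (X \<times> Y))"
    by (rule has_bochner_integral_real_indicator) (use sets em in auto)
  ultimately show ?thesis by (simp only:)
qed

lemma has_bochner_integral_grid_function:
  "has_bochner_integral lebesgue (\<lambda>w. indicator (dyadic_box a b z) w * grid_function q G w)
     (block_mean2 (q - a) (q - b) G (dyadic_index q (fst z)) (dyadic_index q (snd z)) / (2 ^ a * 2 ^ b))"
proof -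
  define X where "X i = {v. dyadic_index a v = dyadic_index a (fst z) \<and> dyadic_index q v = i}" for i
  define Y where "Y j = {v. dyadic_index b v = dyadic_index b (snd z) \<and> dyadic_index q v = j}" for j
  define I where "I = dyadic_block (q - a) (dyadic_index q (fst z))"
  define J where "J = dyadic_block (q - b) (dyadic_index q (snd z))"
  have "indicator (dyadic_box a b z) w * grid_function q G w =
    (\<Sum>i\<in>I. \<Sum>j\<in>J. G i j * indicator (X i \<times> Y j) w)" for w
  proof (cases "w \<in> dyadic_box a b z")
    case True
    obtain u v where w: "w = (u, v)" by fastforce
    have "(\<Sum>i\<in>I. \<Sum>j\<in>J. G i j * indicator (X i \<times> Y j) w) =
      (\<Sum>i\<in>I. if dyadic_index q u = i then \<Sum>j\<in>J. if dyadic_index q v = j then G i j else 0 else 0)"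
      using True by (intro sum.cong refl) (auto simp: w X_def Y_def dyadic_box_def intro!: sum.cong)
    also have "\<dots> = grid_function q G w"
      using True dyadic_index_mem_block
      by (simp add: I_def J_def dyadic_box_def w grid_function_def)
    finally show ?thesis using True by simp
  next
    case False
    then have "w \<notin> X i \<times> Y j" for i j
      by (auto simp: X_def Y_def dyadic_box_def)
    then show ?thesis using False by simp
  qed
  moreover have "has_bochner_integral lebesgue (\<lambda>w. \<Sum>i\<in>I. \<Sum>j\<in>J. G i j * indicator (X i \<times> Y j) w)
    (\<Sum>i\<in>I. \<Sum>j\<in>J. G i j * ((1 / 2 ^ a / 2 ^ (q - a)) * (1 / 2 ^ b / 2 ^ (q - b))))"
    unfolding X_def Y_def I_def J_def
    by (intro has_bochner_integral_sum has_bochner_integral_mult_right has_bochner_integral_rectangle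
        sets_dyadic_slice emeasure_dyadic_slice) auto
  moreover have "(\<Sum>i\<in>I. \<Sum>j\<in>J. G i j * ((1 / 2 ^ a / 2 ^ (q - a)) * (1 / 2 ^ b / 2 ^ (q - b)))) =
    block_mean2 (q - a) (q - b) G (dyadic_index q (fst z)) (dyadic_index q (snd z)) / (2 ^ a * 2 ^ b)"
    by (simp add: block_mean2_sum I_def J_def mult_ac flip: sum_divide_distrib)
  ultimately show ?thesis by simp
qed

lemma measure_dyadic_box: "measure lebesgue (dyadic_box a b z) = 1 / (2 ^ a * 2 ^ b)"
proof -
  have "has_bochner_integral lebesgue (indicator (dyadic_box a b z) :: _ \<Rightarrow> real) ((1 / 2 ^ a) * (1 / 2 ^ b))"
    unfolding dyadic_box_def
    by (intro has_bochner_integral_rectangle) (auto simp: dyadic_index_level)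
  then show ?thesis
    by (simp add: has_bochner_integral_iff)
qed

lemma sets_dyadic_box: "dyadic_box a b z \<in> sets lebesgue"
proof -
  have "dyadic_box a b z \<in> sets borel"
    unfolding dyadic_box_def by (metis borel_prod pair_measureI sets_dyadic_level)
  then show ?thesis by simp
qed

lemma average_grid_function:
  "average (dyadic_box a b z) (grid_function q G) =
     block_mean2 (q - a) (q - b) G (dyadic_index q (fst z)) (dyadic_index q (snd z))"
  using has_bochner_integral_grid_function[of a b z q G]
  by (simp add: average_def measure_dyadic_box set_lebesgue_integral_def has_bochner_integral_iff)

lemma self_mem_dyadic_box: "z \<in> dyadic_box a b z"
  by (simp add: dyadic_box_def mem_Times_iff)

lemma dyadic_box_antimono: "a \<le> a' \<Longrightarrow> b \<le> b' \<Longrightarrow> dyadic_box a' b' z \<subseteq> dyadic_box a b z"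
  by (auto simp: dyadic_box_def dest: dyadic_index_refine)

lemma dyadic_box_in_dyadic_rectangles: "dyadic_box a b z \<in> dyadic_rectangles UNIV"
proof -
  have "dyadic_box a b z = dyadic_interval (int a) (dyadic_index a (fst z) + 1) \<times>
    dyadic_interval (int b) (dyadic_index b (snd z) + 1)"
    by (simp add: dyadic_box_def dyadic_interval_eq_level)
  then show ?thesis
    unfolding dyadic_rectangles_def by blast
qed

lemma dyadic_rectangle_cases:
  assumes "R \<in> dyadic_rectangles (int ` A)" and "z \<in> R"
  obtains a b where "a \<in> A" "b \<in> A" "R = dyadic_box a b z"
proof -
  obtain a b j1 j2 where ab: "a \<in> A" "b \<in> A"
    and R: "R = dyadic_interval (int a) j1 \<times> dyadic_interval (int b) j2"
    using assms(1) by (auto simp: dyadic_rectangles_def)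
  have "R = dyadic_box a b z"
    using assms(2) unfolding R dyadic_interval_eq_level dyadic_box_def by auto
  then show thesis using that ab by blast
qed

lemma longer_side_dyadic_box: "longer_side (dyadic_box a b z) = max (1 / 2 ^ a) (1 / 2 ^ b)"
  unfolding dyadic_box_def dyadic_index_level by (subst longer_side_rectangle) auto

text \<open>A half-open box does not attain its side lengths, hence the factor: half of each side is realised by
  two points of the box.\<close>
lemma longer_side_le_diameter: "longer_side (dyadic_box a b z) / 2 \<le> diameter (dyadic_box a b z)"
proof -
  have bdd: "bounded (dyadic_box a b z)"
    unfolding dyadic_box_def dyadic_index_level by (intro bounded_Times) auto
  define u v where "u = of_int (dyadic_index a (fst z)) / (2::real) ^ a"
    and "v = of_int (dyadic_index b (snd z)) / (2::real) ^ b"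
  have box: "dyadic_box a b z = {u..<u + 1 / 2 ^ a} \<times> {v..<v + 1 / 2 ^ b}"
    by (simp add: dyadic_box_def dyadic_index_level u_def v_def)
  have "dist (u, v) (u + 1 / 2 ^ a / 2, v) \<le> diameter (dyadic_box a b z)"
    by (rule diameter_bounded_bound[OF bdd]) (auto simp: box field_simps)
  moreover have "dist (u, v) (u, v + 1 / 2 ^ b / 2) \<le> diameter (dyadic_box a b z)"
    by (rule diameter_bounded_bound[OF bdd]) (auto simp: box field_simps)
  ultimately show ?thesis
    by (auto simp: longer_side_dyadic_box dist_Pair_Pair dist_real_def max_def)
qed

section \<open>Domination along a sparse set of scales\<close>

text \<open>If no admissible scale lies strictly between the period and the cells of a pattern, an admissible
  rectangle sees in each direction either a single cell or whole periods. So only four averages occur: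
  the value, the two strip means, and the mean over a period. Their sum bounds all averages, and its own
  mean is at most \<open>4 * \<mu>\<close>.\<close>
definition pattern_majorant :: "real \<Rightarrow> nat \<Rightarrow> (int \<Rightarrow> int \<Rightarrow> real) \<Rightarrow> int \<Rightarrow> int \<Rightarrow> real" where
  "pattern_majorant \<mu> L G i j = G i j + block_mean L (G i) j + block_mean L (\<lambda>k. G k j) i + \<mu>"

lemma block_mean2_add:
  "block_mean2 c d (\<lambda>k l. G k l + H k l) i j = block_mean2 c d G i j + block_mean2 c d H i j"
  by (simp add: block_mean2_def block_mean_add)

lemma covering_patternD:
  assumes "covering_pattern \<Lambda> \<mu> L G"
  shows "0 \<le> G i j"
    and "j mod 2 ^ L = j' mod 2 ^ L \<Longrightarrow> G i j = G i j'"
    and "i mod 2 ^ L = i' mod 2 ^ L \<Longrightarrow> G i j = G i' j"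
    and "block_mean2 L L G i j \<le> \<mu>"
    and "\<exists>c\<le>L. \<exists>d\<le>L. \<Lambda> \<le> block_mean2 c d G i j"
  using assms unfolding covering_pattern_def by blast+

lemma pattern_row_mean:
  assumes "covering_pattern \<Lambda> \<mu> L G" and "L \<le> d"
  shows "block_mean d (G i) j = block_mean L (G i) j'"
  by (rule block_mean_periodic[OF covering_patternD(2)[OF assms(1)] assms(2)])

lemma pattern_column_mean:
  assumes "covering_pattern \<Lambda> \<mu> L G" and "L \<le> c"
  shows "block_mean c (\<lambda>k. G k j) i = block_mean L (\<lambda>k. G k j) i'"
  by (rule block_mean_periodic[OF covering_patternD(3)[OF assms(1)] assms(2)])

lemma pattern_block_mean2:
  assumes pat: "covering_pattern \<Lambda> \<mu> L G" and "L \<le> c" "L \<le> d"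
  shows "block_mean2 c d G i j \<le> \<mu>"
proof -
  have "block_mean2 c d G i j = block_mean c (\<lambda>k. block_mean L (G k) j) i"
    unfolding block_mean2_def by (simp only: pattern_row_mean[OF pat \<open>L \<le> d\<close>, of _ j j])
  also have "\<dots> = block_mean2 c L G i j"
    by (simp add: block_mean2_def)
  also have "\<dots> = block_mean L (\<lambda>l. block_mean L (\<lambda>k. G k l) i) j"
    unfolding block_mean2_swap by (simp only: pattern_column_mean[OF pat \<open>L \<le> c\<close>, of _ i i])
  also have "\<dots> = block_mean2 L L G i j"
    by (simp add: block_mean2_swap)
  finally show ?thesis
    using covering_patternD(4)[OF pat] by simp
qed

lemma pattern_majorant_dominates:
  assumes pat: "covering_pattern \<Lambda> \<mu> L G" and "c = 0 \<or> L \<le> c" "d = 0 \<or> L \<le> d" and "0 \<le> \<mu>"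
  shows "block_mean2 c d G i j \<le> pattern_majorant \<mu> L G i j"
proof -
  have nonneg: "0 \<le> G i j" "0 \<le> block_mean L (G i) j" "0 \<le> block_mean L (\<lambda>k. G k j) i"
    using covering_patternD(1)[OF pat] by (auto intro: block_mean_nonneg)
  consider "c = 0" "d = 0" | "c = 0" "L \<le> d" | "L \<le> c" "d = 0" | "L \<le> c" "L \<le> d"
    using assms(2,3) by blast
  then show ?thesis
  proof cases
    case 1
    then show ?thesis using nonneg \<open>0 \<le> \<mu>\<close> by (simp add: pattern_majorant_def block_mean2_def)
  next
    case 2
    then have "block_mean2 c d G i j = block_mean L (G i) j"
      using pattern_row_mean[OF pat] by (simp add: block_mean2_def)
    then show ?thesis using nonneg \<open>0 \<le> \<mu>\<close> by (simp add: pattern_majorant_def)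
  next
    case 3
    then have "block_mean2 c d G i j = block_mean L (\<lambda>k. G k j) i"
      using pattern_column_mean[OF pat] by (simp add: block_mean2_def)
    then show ?thesis using nonneg \<open>0 \<le> \<mu>\<close> by (simp add: pattern_majorant_def)
  next
    case 4
    then show ?thesis
      using pattern_block_mean2[OF pat, of c d i j] nonneg by (simp add: pattern_majorant_def)
  qed
qed

lemma pattern_majorant_nonneg:
  assumes pat: "covering_pattern \<Lambda> \<mu> L G" and "0 \<le> \<mu>"
  shows "0 \<le> pattern_majorant \<mu> L G i j"
  using covering_patternD(1)[OF pat] \<open>0 \<le> \<mu>\<close>
  by (auto simp: pattern_majorant_def intro!: add_nonneg_nonneg block_mean_nonneg)

lemma pattern_majorant_mean:
  assumes pat: "covering_pattern \<Lambda> \<mu> L G" and cd: "L \<le> c" "L \<le> d"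
  shows "block_mean2 c d (pattern_majorant \<mu> L G) i j \<le> 4 * \<mu>"
proof -
  have row: "block_mean d (block_mean L (G k)) j = block_mean L (G k) j" for k
  proof -
    have "block_mean L (G k) = (\<lambda>_. block_mean L (G k) j)"
      by (intro ext pattern_row_mean[OF pat order_refl])
    then show ?thesis by (metis block_mean_const)
  qed
  have column: "block_mean c (block_mean L (\<lambda>k. G k l)) i = block_mean L (\<lambda>k. G k l) i" for l
  proof -
    have "block_mean L (\<lambda>k. G k l) = (\<lambda>_. block_mean L (\<lambda>k. G k l) i)"
      by (intro ext pattern_column_mean[OF pat order_refl])
    then show ?thesis by (metis block_mean_const)
  qed
  have "block_mean2 c d (\<lambda>i j. block_mean L (G i) j) i j = block_mean2 c L G i j"
    by (simp add: block_mean2_def row)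
  moreover have "block_mean2 c d (\<lambda>i j. block_mean L (\<lambda>k. G k j) i) i j = block_mean2 L d G i j"
    by (simp add: block_mean2_swap column)
  moreover have "block_mean2 c d (\<lambda>_ _. \<mu>) i j = \<mu>"
    by (simp add: block_mean2_def)
  moreover have "pattern_majorant \<mu> L G = (\<lambda>i j. G i j + block_mean L (G i) j + block_mean L (\<lambda>k. G k j) i + \<mu>)"
    by (intro ext) (simp add: pattern_majorant_def)
  ultimately show ?thesis
    using pattern_block_mean2[OF pat, of c d i j] pattern_block_mean2[OF pat, of c L i j]
      pattern_block_mean2[OF pat, of L d i j] cd
    by (simp add: block_mean2_add)
qed

section \<open>Superposition of the layers\<close>

text \<open>Layer \<open>k\<close> is a covering pattern with period \<open>1 / 2 ^ p k\<close> and cells of side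
  \<open>1 / 2 ^ (p k + L k)\<close>, placed in a gap of the set \<open>A\<close> of admissible scales. The levels \<open>k\<close> tend to
  infinity although the means \<open>(1 / 2) ^ k\<close> are summable.\<close>
locale gap_patterns =
  fixes A :: "nat set" and p L :: "nat \<Rightarrow> nat" and G :: "nat \<Rightarrow> int \<Rightarrow> int \<Rightarrow> real"
  assumes pattern: "covering_pattern (real k) ((1 / 2) ^ k) (L k) (G k)"
    and deep: "k \<le> p k"
    and gap: "a \<in> A \<Longrightarrow> a \<le> p k \<or> p k + L k \<le> a"
    and unbounded: "\<exists>a\<in>A. N < a"
begin

definition layer :: "nat \<Rightarrow> real \<times> real \<Rightarrow> real" where
  "layer k = grid_function (p k + L k) (G k)"

definition majorant :: "nat \<Rightarrow> real \<times> real \<Rightarrow> real" where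
  "majorant k = grid_function (p k + L k) (pattern_majorant ((1 / 2) ^ k) (L k) (G k))"

definition layer_sum :: "real \<times> real \<Rightarrow> real" where
  "layer_sum z = (\<Sum>k. layer k z)"

lemma layer_nonneg: "0 \<le> layer k z"
  using covering_patternD(1)[OF pattern] by (simp add: layer_def grid_function_def)

lemma majorant_nonneg: "0 \<le> majorant k z"
  using pattern_majorant_nonneg[OF pattern] by (simp add: majorant_def grid_function_def)

lemma layer_le_majorant: "layer k z \<le> majorant k z"
  using pattern_majorant_dominates[OF pattern, of 0 _ 0]
  by (simp add: layer_def majorant_def grid_function_def block_mean2_def)

lemma average_layer_le_majorant:
  assumes "a \<in> A" "b \<in> A"
  shows "average (dyadic_box a b z) (layer k) \<le> majorant k z"
proof -
  have "p k + L k - a = 0 \<or> L k \<le> p k + L k - a" "p k + L k - b = 0 \<or> L k \<le> p k + L k - b"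
    using gap[OF assms(1), of k] gap[OF assms(2), of k] by auto
  then show ?thesis
    unfolding layer_def average_grid_function majorant_def
    by (simp add: grid_function_def pattern_majorant_dominates[OF pattern])
qed

lemma average_layer_nonneg: "0 \<le> average (dyadic_box a b z) (layer k)"
  unfolding layer_def average_grid_function
  by (rule block_mean2_nonneg) (rule covering_patternD(1)[OF pattern])

lemma average_layer_fine:
  assumes "p k + L k \<le> a" "p k + L k \<le> b"
  shows "average (dyadic_box a b z) (layer k) = layer k z"
  using assms by (simp add: layer_def average_grid_function block_mean2_def grid_function_def)

lemma integrable_layer: "integrable lebesgue (\<lambda>w. indicator (dyadic_box a b z) w * layer k w)"
  using has_bochner_integral_grid_function by (auto simp: layer_def has_bochner_integral_iff)

lemma integrable_majorant: "integrable lebesgue (\<lambda>w. indicator (dyadic_box a b z) w * majorant k w)"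
  using has_bochner_integral_grid_function by (auto simp: majorant_def has_bochner_integral_iff)

lemma integral_majorant_unit_square:
  "(\<integral>w. indicator (dyadic_box 0 0 z) w * majorant k w \<partial>lebesgue) \<le> 4 * (1 / 2) ^ k"
  using has_bochner_integral_grid_function[of 0 0 z] pattern_majorant_mean[OF pattern]
  by (simp add: majorant_def has_bochner_integral_iff)

lemma integral_layer_le: "(\<integral>w. indicator (dyadic_box a b z) w * layer k w \<partial>lebesgue) \<le> 4 * (1 / 2) ^ k"
proof -
  have "indicator (dyadic_box a b z) w * layer k w \<le> indicator (dyadic_box 0 0 z) w * majorant k w" for w
    using dyadic_box_antimono[of 0 a 0 b z] layer_le_majorant[of k w] majorant_nonneg[of k w]
    by (auto simp: indicator_def)
  then have "(\<integral>w. indicator (dyadic_box a b z) w * layer k w \<partial>lebesgue) \<le>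
    (\<integral>w. indicator (dyadic_box 0 0 z) w * majorant k w \<partial>lebesgue)"
    by (intro integral_mono integrable_layer integrable_majorant)
  then show ?thesis
    using integral_majorant_unit_square[of z k] by linarith
qed

lemma summable_bound: "summable (\<lambda>k. 4 * (1 / 2) ^ k :: real)"
  by (intro summable_mult summable_geometric) auto

text \<open>The integrals of the majorants over a unit square form a convergent series, so by monotone
  convergence the majorants themselves are summable almost everywhere.\<close>
lemma AE_summable_majorant: "AE z in lebesgue. summable (\<lambda>k. majorant k z)"
proof -
  have unit_square: "AE w in lebesgue. w \<in> dyadic_box 0 0 z \<longrightarrow> summable (\<lambda>k. majorant k w)" for z
  proof -
    let ?h = "\<lambda>k w. indicator (dyadic_box 0 0 z) w * majorant k w"
    have meas: "?h k \<in> borel_measurable lebesgue" for k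
      using integrable_majorant[of 0 0 z k] by (rule borel_measurable_integrable)
    have int: "(\<integral>\<^sup>+ w. ennreal (?h k w) \<partial>lebesgue) \<le> ennreal (4 * (1 / 2) ^ k)" for k
    proof -
      have "(\<integral>\<^sup>+ w. ennreal (?h k w) \<partial>lebesgue) = ennreal (\<integral>w. ?h k w \<partial>lebesgue)"
        by (intro nn_integral_eq_integral integrable_majorant) (simp add: majorant_nonneg)
      also have "\<dots> \<le> ennreal (4 * (1 / 2) ^ k)"
        by (intro ennreal_leI integral_majorant_unit_square)
      finally show ?thesis .
    qed
    have "(\<integral>\<^sup>+ w. (\<Sum>k. ennreal (?h k w)) \<partial>lebesgue) = (\<Sum>k. \<integral>\<^sup>+ w. ennreal (?h k w) \<partial>lebesgue)"
      by (intro nn_integral_suminf measurable_compose[OF meas measurable_ennreal])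
    also have "\<dots> \<le> (\<Sum>k. ennreal (4 * (1 / 2) ^ k))"
      by (intro suminf_le int) auto
    also have "\<dots> < \<infinity>"
      unfolding infinity_ennreal_def less_top[symmetric]
      by (intro ennreal_suminf_neq_top summable_bound) simp
    finally have "AE w in lebesgue. (\<Sum>k. ennreal (?h k w)) \<noteq> \<infinity>"
      by (intro nn_integral_noteq_infinite borel_measurable_suminf_order
          measurable_compose[OF meas measurable_ennreal]) simp
    then show ?thesis
    proof (rule AE_mp[OF _ AE_I2])
      fix w
      show "(\<Sum>k. ennreal (?h k w)) \<noteq> \<infinity> \<longrightarrow> w \<in> dyadic_box 0 0 z \<longrightarrow> summable (\<lambda>k. majorant k w)"
      proof (intro impI)
        assume "(\<Sum>k. ennreal (?h k w)) \<noteq> \<infinity>" and "w \<in> dyadic_box 0 0 z"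
        then have "(\<Sum>k. ennreal (majorant k w)) \<noteq> top" by simp
        then show "summable (\<lambda>k. majorant k w)"
          by (intro summable_suminf_not_top majorant_nonneg)
      qed
    qed
  qed
  have "AE w in lebesgue. \<forall>i j. w \<in> dyadic_box 0 0 (of_int i, of_int j) \<longrightarrow> summable (\<lambda>k. majorant k w)"
    unfolding AE_all_countable by (intro allI unit_square)
  then show ?thesis
  proof (rule AE_mp[OF _ AE_I2], intro impI)
    fix w
    assume all: "\<forall>i j. w \<in> dyadic_box 0 0 (of_int i, of_int j) \<longrightarrow> summable (\<lambda>k. majorant k w)"
    have "w \<in> dyadic_box 0 0 (of_int \<lfloor>fst w\<rfloor>, of_int \<lfloor>snd w\<rfloor>)"
      by (simp add: dyadic_box_def dyadic_index_def mem_Times_iff)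
    with all show "summable (\<lambda>k. majorant k w)" by blast
  qed
qed

text \<open>At the null set of points where the series diverges, \<^const>\<open>suminf\<close> returns an unspecified value; this
  does not affect integrals.\<close>
lemma
  shows set_integrable_layer_sum: "set_integrable lebesgue (dyadic_box a b z) layer_sum"
    and average_layer_sum_sums: "(\<lambda>k. average (dyadic_box a b z) (layer k)) sums average (dyadic_box a b z) layer_sum"
proof -
  let ?h = "\<lambda>k w. indicator (dyadic_box a b z) w * layer k w"
  have norm: "norm (?h k w) = ?h k w" for k w
    by (simp add: layer_nonneg)
  have ae: "AE w in lebesgue. summable (\<lambda>k. norm (?h k w))"
    using AE_summable_majorant
  proof (rule AE_mp[OF _ AE_I2], intro impI)
    fix w
    assume "summable (\<lambda>k. majorant k w)"
    then have "summable (\<lambda>k. layer k w)"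
      by (rule summable_comparison_test'[where N = 0]) (simp add: layer_nonneg layer_le_majorant)
    then show "summable (\<lambda>k. norm (?h k w))"
      unfolding norm by (rule summable_mult)
  qed
  have sums: "summable (\<lambda>k. \<integral>w. norm (?h k w) \<partial>lebesgue)"
    unfolding norm
  proof (rule summable_comparison_test'[OF summable_bound, where N = 0])
    fix k
    have "0 \<le> (\<integral>w. ?h k w \<partial>lebesgue)"
      by (intro integral_nonneg_AE AE_I2) (simp add: layer_nonneg)
    then show "norm (\<integral>w. ?h k w \<partial>lebesgue) \<le> 4 * (1 / 2) ^ k"
      using integral_layer_le[of a b z k] by simp
  qed
  have sum_eq: "(\<lambda>w. \<Sum>k. ?h k w) = (\<lambda>w. indicator (dyadic_box a b z) w *\<^sub>R layer_sum w)"
    by (auto simp: layer_sum_def indicator_def)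
  show "set_integrable lebesgue (dyadic_box a b z) layer_sum"
    using integrable_suminf[OF integrable_layer ae sums] by (simp add: set_integrable_def sum_eq)
  have "(\<lambda>k. \<integral>w. ?h k w \<partial>lebesgue) sums (LINT w:dyadic_box a b z|lebesgue. layer_sum w)"
    using sums_integral[OF integrable_layer ae sums] by (simp add: set_lebesgue_integral_def sum_eq)
  then show "(\<lambda>k. average (dyadic_box a b z) (layer k)) sums average (dyadic_box a b z) layer_sum"
    unfolding average_def by (intro sums_divide) (simp add: set_lebesgue_integral_def)
qed

lemma locally_integrable_layer_sum: "locally_integrable layer_sum"
  unfolding locally_integrable_def
proof (intro allI impI)
  fix K :: "(real \<times> real) set"
  assume "compact K"
  then obtain M where M: "\<And>w. w \<in> K \<Longrightarrow> norm w \<le> M"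
    using compact_imp_bounded by (meson bounded_iff)
  define I where "I = {\<lfloor>- M\<rfloor>..\<lfloor>M\<rfloor>}"
  let ?U = "\<Union>z\<in>I \<times> I. dyadic_box 0 0 (of_int (fst z), of_int (snd z))"
  have "K \<subseteq> ?U"
  proof
    fix w assume "w \<in> K"
    then have "\<bar>fst w\<bar> \<le> M" "\<bar>snd w\<bar> \<le> M"
      using M[of w] norm_fst_le[of "fst w" "snd w"] norm_snd_le[of "snd w" "fst w"] by auto
    then have "\<lfloor>fst w\<rfloor> \<in> I" "\<lfloor>snd w\<rfloor> \<in> I"
      by (auto simp: I_def intro!: floor_mono)
    moreover have "w \<in> dyadic_box 0 0 (of_int \<lfloor>fst w\<rfloor>, of_int \<lfloor>snd w\<rfloor>)"
      by (simp add: dyadic_box_def dyadic_index_def mem_Times_iff)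
    ultimately show "w \<in> ?U" by force
  qed
  moreover have "set_integrable lebesgue ?U layer_sum"
    by (intro set_integrable_UN set_integrable_layer_sum sets_dyadic_box) (simp add: I_def)
  moreover have "K \<in> sets lebesgue"
    using borel_compact[OF \<open>compact K\<close>] by simp
  ultimately show "set_integrable lebesgue K layer_sum"
    by (blast intro: set_integrable_subset)
qed

text \<open>A layer with cells larger than the box is constant on it, so its average is its value. The remaining
  layers contribute, both to the average and to the value, between \<open>0\<close> and their majorants at \<open>z\<close>,
  which form the tail of a convergent series.\<close>
lemma diff_defect_layer_sum:
  assumes summable: "summable (\<lambda>k. majorant k z)"
  shows "diff_defect (dyadic_rectangles (int ` A)) z layer_sum = 0"
proof -
  let ?B = "dyadic_rectangles (int ` A)"
  have "differentiation_basis ?B"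
  proof (rule differentiation_basis_dyadic_rectangles)
    fix N
    obtain a where "a \<in> A" "nat N < a" using unbounded by blast
    then show "\<exists>m\<in>int ` A. N < m" by (intro bexI[of _ "int a"]) auto
  qed
  then have small: "\<exists>E\<in>?B. z \<in> E \<and> diameter E < \<epsilon>" if "\<epsilon> > 0" for \<epsilon>
    using that unfolding differentiation_basis_def by blast
  have nontrivial: "\<not> trivial_limit (shrinking_at diameter ?B z)"
  proof
    assume "trivial_limit (shrinking_at diameter ?B z)"
    then have "eventually (\<lambda>_. False) (shrinking_at diameter ?B z)"
      by (simp add: trivial_limit_def)
    then obtain \<epsilon> where \<epsilon>: "\<epsilon> > 0" "\<forall>E\<in>?B. z \<in> E \<longrightarrow> \<not> \<bar>diameter E\<bar> < \<epsilon>"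
      unfolding shrinking_at_eventually by blast
    obtain E where E: "E \<in> ?B" "z \<in> E" "diameter E < \<epsilon>" using small \<epsilon>(1) by blast
    obtain a b where "E = dyadic_box a b z"
      using dyadic_rectangle_cases[OF E(1,2)] by metis
    then have "0 \<le> diameter E"
      using longer_side_le_diameter[of a b z] longer_side_dyadic_box[of a b z]
      by (simp add: max_def split: if_splits) (smt (verit) divide_nonneg_nonneg zero_le_power)+
    with \<epsilon>(2) E show False by auto
  qed
  have "((\<lambda>E. \<bar>average E layer_sum - layer_sum z\<bar>) \<longlongrightarrow> 0) (shrinking_at diameter ?B z)"
  proof (rule tendstoI)
    fix e :: real assume "0 < e"
    obtain K where K: "norm (\<Sum>i. majorant (i + K) z) < e"
      using suminf_exist_split[OF \<open>0 < e\<close> summable] by blast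
    \<comment> \<open>At least as fine as the cells of each of the first \<open>K\<close> layers.\<close>
    define Q where "Q = (\<Sum>k<K. p k + L k)"
    define r :: real where "r = 1 / 2 ^ Q"
    have Q: "p k + L k \<le> Q" if "k < K" for k
      unfolding Q_def using that by (intro member_le_sum) auto
    have tail: "summable (\<lambda>i. majorant (i + K) z)"
      using summable by (rule summable_ignore_initial_segment)
    have "\<bar>average E layer_sum - layer_sum z\<bar> < e" if E: "E \<in> ?B" "z \<in> E" "\<bar>diameter E\<bar> < r / 2" for E
    proof -
      obtain a b where ab: "a \<in> A" "b \<in> A" and box: "E = dyadic_box a b z"
        using dyadic_rectangle_cases[OF E(1,2)] by metis
      have "longer_side E < r"
        using longer_side_le_diameter[of a b z] E(3) unfolding box by linarith
      then have "max (1 / 2 ^ a) (1 / 2 ^ b) < (1 / 2 ^ Q :: real)"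
        unfolding box longer_side_dyadic_box r_def .
      then have "1 / 2 ^ a < (1 / 2 ^ Q :: real)" "1 / 2 ^ b < (1 / 2 ^ Q :: real)"
        by (simp_all only: max_less_iff_conj)
      then have "Q \<le> a" "Q \<le> b"
        by (simp_all add: field_simps)
      then have fine: "average E (layer k) = layer k z" if "k < K" for k
        unfolding box using Q[OF that] by (intro average_layer_fine) auto
      have "summable (\<lambda>k. layer k z)"
        by (rule summable_comparison_test'[OF summable, where N = 0]) (simp add: layer_nonneg layer_le_majorant)
      then have "(\<lambda>k. layer k z) sums layer_sum z"
        unfolding layer_sum_def by (rule summable_sums)
      then have "(\<lambda>k. average E (layer k) - layer k z) sums (average E layer_sum - layer_sum z)"
        unfolding box by (intro sums_diff average_layer_sum_sums)
      then have "(\<lambda>i. average E (layer (i + K)) - layer (i + K) z) sums (average E layer_sum - layer_sum z)"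
        by (subst sums_iff_shift) (simp add: fine)
      then have "\<bar>average E layer_sum - layer_sum z\<bar> = norm (\<Sum>i. average E (layer (i + K)) - layer (i + K) z)"
        by (simp add: sums_iff)
      also have "\<dots> \<le> (\<Sum>i. majorant (i + K) z)"
      proof (rule norm_suminf_le[OF _ tail])
        fix i
        show "norm (average E (layer (i + K)) - layer (i + K) z) \<le> majorant (i + K) z"
          using average_layer_le_majorant[OF ab, of z "i + K"] average_layer_nonneg[of a b z "i + K"]
            layer_le_majorant[of "i + K" z] layer_nonneg[of "i + K" z]
          by (simp add: box)
      qed
      also have "\<dots> < e" using K by simp
      finally show ?thesis .
    qed
    then show "\<forall>\<^sub>F E in shrinking_at diameter ?B z. dist \<bar>average E layer_sum - layer_sum z\<bar> 0 < e"
      unfolding shrinking_at_eventually by (intro exI[of _ "r / 2"]) (simp add: r_def)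
  qed
  then have "((\<lambda>E. ereal \<bar>average E layer_sum - layer_sum z\<bar>) \<longlongrightarrow> ereal 0) (shrinking_at diameter ?B z)"
    by (rule tendsto_ereal)
  then show ?thesis
    unfolding diff_defect_def by (simp add: lim_imp_Limsup[OF nontrivial] zero_ereal_def)
qed

lemma layer_sum_differentiated: "layer_sum \<in> differentiated_functions (dyadic_rectangles (int ` A))"
  unfolding differentiated_functions_def
  using locally_integrable_layer_sum AE_summable_majorant diff_defect_layer_sum by auto

text \<open>At every point \<open>z\<close> layer \<open>n\<close> has a dyadic box with average at least \<open>n\<close> and sides at most
  \<open>1 / 2 ^ p n\<close>; the other layers are nonnegative and cannot cancel this.\<close>
lemma layer_sum_unbounded_averages:
  "Limsup (shrinking_at longer_side (dyadic_rectangles UNIV) z) (\<lambda>R. ereal \<bar>average R layer_sum\<bar>) = \<infinity>"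
proof -
  have large: "(SUP R\<in>{R. P R}. ereal \<bar>average R layer_sum\<bar>) = \<infinity>"
    if "eventually P (shrinking_at longer_side (dyadic_rectangles UNIV) z)" for P
  proof (rule ereal_top)
    fix C :: real
    obtain \<epsilon> where "\<epsilon> > 0"
      and \<epsilon>: "\<And>R. R \<in> dyadic_rectangles UNIV \<Longrightarrow> z \<in> R \<Longrightarrow> \<bar>longer_side R\<bar> < \<epsilon> \<Longrightarrow> P R"
      using \<open>eventually P _\<close> unfolding shrinking_at_eventually by blast
    obtain n0 where n0: "(1 / 2) ^ n0 < \<epsilon>"
      using real_arch_pow_inv[OF \<open>\<epsilon> > 0\<close>, of "1 / 2"] by auto
    obtain n1 :: nat where n1: "C \<le> n1" using real_arch_simple by blast
    \<comment> \<open>One index for both demands: \<open>n1\<close> makes the average large, \<open>n0 \<le> p n\<close> the box small.\<close>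
    define n where "n = max n0 n1"
    obtain c d where cd: "c \<le> L n" "d \<le> L n"
      and mean: "n \<le> block_mean2 c d (G n) (dyadic_index (p n + L n) (fst z)) (dyadic_index (p n + L n) (snd z))"
      using covering_patternD(5)[OF pattern] by blast
    define a b where "a = p n + L n - c" and "b = p n + L n - d"
    have "n1 \<le> n" by (simp add: n_def)
    with n1 have n1: "C \<le> n" by linarith
    have ab: "n0 \<le> a" "n0 \<le> b" "p n + L n - a = c" "p n + L n - b = d"
      using cd deep[of n] by (auto simp: a_def b_def n_def)
    have "(2::real) ^ n0 \<le> 2 ^ a" "(2::real) ^ n0 \<le> 2 ^ b"
      using ab by (auto intro: power_increasing)
    then have "1 / 2 ^ a \<le> (1 / 2 ^ n0 :: real)" "1 / 2 ^ b \<le> (1 / 2 ^ n0 :: real)"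
      by (auto intro: frac_le)
    then have "\<bar>longer_side (dyadic_box a b z)\<bar> < \<epsilon>"
      using n0 by (auto simp: longer_side_dyadic_box power_one_over max_def)
    then have "P (dyadic_box a b z)"
      by (intro \<epsilon> dyadic_box_in_dyadic_rectangles self_mem_dyadic_box)
    moreover have "C \<le> \<bar>average (dyadic_box a b z) layer_sum\<bar>"
    proof -
      have "C \<le> average (dyadic_box a b z) (layer n)"
        using n1 mean ab by (simp add: layer_def average_grid_function n_def[symmetric])
      also have "\<dots> \<le> (\<Sum>k. average (dyadic_box a b z) (layer k))"
        using sum_le_suminf[OF sums_summable[OF average_layer_sum_sums], of "{n}" a b z]
        by (simp add: average_layer_nonneg)
      also have "\<dots> = average (dyadic_box a b z) layer_sum"
        using average_layer_sum_sums by (rule sums_unique[symmetric])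
      finally show ?thesis by simp
    qed
    ultimately show "ereal C \<le> (SUP R\<in>{R. P R}. ereal \<bar>average R layer_sum\<bar>)"
      by (intro SUP_upper2[of "dyadic_box a b z"]) auto
  qed
  then have "(INF P\<in>{P. eventually P (shrinking_at longer_side (dyadic_rectangles UNIV) z)}.
      SUP R\<in>{R. P R}. ereal \<bar>average R layer_sum\<bar>) \<ge> \<infinity>"
    by (intro INF_greatest) simp
  then show ?thesis
    unfolding Limsup_def by simp
qed

end

section \<open>Gaps of the scale sequence\<close>

text \<open>The gaps before any given index are finitely many, hence bounded, so the supremum is already infinite
  over the later ones.\<close>
lemma unbounded_gap_beyond:
  fixes \<nu> :: "nat \<Rightarrow> int"
  assumes "(SUP k. ereal (of_int (\<nu> (Suc k) - \<nu> k))) = \<infinity>"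
  shows "\<exists>m\<ge>k. C \<le> \<nu> (Suc m) - \<nu> m"
proof (rule ccontr)
  assume "\<not> ?thesis"
  then have less: "\<nu> (Suc m) - \<nu> m \<le> C" if "k \<le> m" for m
    using that by force
  define S where "S = insert C ((\<lambda>m. \<nu> (Suc m) - \<nu> m) ` {..<k})"
  have "\<nu> (Suc m) - \<nu> m \<le> Max S" for m
  proof (cases "k \<le> m")
    case True
    then show ?thesis using less[of m] by (auto simp: S_def intro: order_trans[OF _ Max_ge])
  next
    case False
    then show ?thesis by (intro Max_ge) (auto simp: S_def)
  qed
  then have "(SUP k. ereal (of_int (\<nu> (Suc k) - \<nu> k))) \<le> ereal (of_int (Max S))"
    by (intro SUP_least) (simp only: ereal_less_eq of_int_le_iff)
  then show False using assms by simp
qed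

theorem theorem3p2:
  fixes \<nu> :: "nat \<Rightarrow> int"
  assumes "strict_mono \<nu>"
    and "\<And>k. \<nu> k > 0"
    and "(SUP k. ereal (of_int (\<nu> (Suc k) - \<nu> k))) = \<infinity>"
  shows "\<exists>f \<in> differentiated_functions (dyadic_rectangles (range \<nu>)).
           \<forall>x. Limsup (shrinking_at longer_side (dyadic_rectangles UNIV) x)
                  (\<lambda>R. ereal \<bar>average R f\<bar>) = \<infinity>"
proof -
  define A where "A = nat ` range \<nu>"
  have nat_\<nu>: "int (nat (\<nu> k)) = \<nu> k" for k
    using assms(2)[of k] by simp
  have A: "int ` A = range \<nu>"
    unfolding A_def image_image nat_\<nu> ..
  have "\<forall>k. \<exists>L G. covering_pattern (real k) ((1 / 2) ^ k) L G"
    by (intro allI covering_pattern_exists) auto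
  then obtain L G where LG: "\<And>k. covering_pattern (real k) ((1 / 2) ^ k) (L k) (G k)"
    by metis
  have "\<forall>k. \<exists>m\<ge>k. int (L k) \<le> \<nu> (Suc m) - \<nu> m"
    using unbounded_gap_beyond[OF assms(3)] by blast
  then obtain m where m: "\<And>k. k \<le> m k" "\<And>k. int (L k) \<le> \<nu> (Suc (m k)) - \<nu> (m k)"
    by metis
  have ge: "int k \<le> \<nu> k" for k
  proof (induction k)
    case (Suc k)
    then show ?case using strict_monoD[OF assms(1), of k "Suc k"] by simp
  qed (use assms(2)[of 0] in simp)
  interpret gap_patterns A "\<lambda>k. nat (\<nu> (m k))" L G
  proof
    fix k
    show "covering_pattern (real k) ((1 / 2) ^ k) (L k) (G k)" by (rule LG)
    show "k \<le> nat (\<nu> (m k))" using ge[of "m k"] m(1)[of k] by linarith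
    fix a assume "a \<in> A"
    then obtain j where a: "int a = \<nu> j" using A by (metis imageE image_eqI)
    have "\<nu> j \<le> \<nu> (m k) \<or> \<nu> (Suc (m k)) \<le> \<nu> j"
      using strict_mono_less_eq[OF assms(1)] not_less_eq_eq by blast
    then show "a \<le> nat (\<nu> (m k)) \<or> nat (\<nu> (m k)) + L k \<le> a"
      using a m(2)[of k] nat_\<nu>[of "m k"] by linarith
  next
    fix N
    have "N < nat (\<nu> (Suc N))" using ge[of "Suc N"] by linarith
    then show "\<exists>a\<in>A. N < a" by (auto simp: A_def)
  qed
  show ?thesis
    using layer_sum_differentiated layer_sum_unbounded_averages by (auto simp: A)
qed

end
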